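(* Let $A=\{a_1,a_2,\ldots,a_r\}\subset\mathbb{N}$ with $1<a_1<a_2<\cdots<a_r$ and the $a_i$ pairwise coprime. Then $$\rho(A)=\frac12\left(1+\prod_{i=1}^r\frac{a_i-1}{a_i+1}\right).$$
   Context: A set $S$ of positive integers is $A$-quotient-free if there are no $x,y\in S$ with $x/y\in A$. For $X>0$ let $[X]=\{k\in\mathbb{N}:k\le X\}$. A set $S\subseteq\mathbb{N}$ has asymptotic density $\delta(S)$ if $\lim_{X\to\infty}|S\cap[X]|/X$ exists, and $\delta(S)$ is this limit. $\rho(A)$ is the supremum of $\delta(S)$ over all $A$-quotient-free sets $S$ for which $\delta(S)$ exists. *)

theory Defs
  imports Complex_Main
begin

text \<open>The quotient is taken in the reals; on type nat, division would round down.\<close>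

definition quotient_free :: "nat set \<Rightarrow> nat set \<Rightarrow> bool" where
  "quotient_free A S \<longleftrightarrow>
     (\<forall>x\<in>S. 0 < x) \<and> \<not> (\<exists>x\<in>S. \<exists>y\<in>S. real x / real y \<in> real ` A)"

definition initial_seg :: "real \<Rightarrow> nat set" where
  "initial_seg X = {k. 0 < k \<and> real k \<le> X}"

definition has_asymp_density :: "nat set \<Rightarrow> real \<Rightarrow> bool" where
  "has_asymp_density S d \<longleftrightarrow>
     ((\<lambda>X::real. real (card (S \<inter> initial_seg X)) / X) \<longlongrightarrow> d) at_top"

text \<open>The set below contains 0 (take S empty) and is bounded above by 1, so the
  supremum over the reals is a genuine one.\<close>

definition rho :: "nat set \<Rightarrow> real" where
  "rho A = Sup {d. \<exists>S. quotient_free A S \<and> has_asymp_density S d}"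

end

theory Submission
  imports Defs "HOL-Computational_Algebra.Primes" "HOL-Real_Asymp.Real_Asymp" "HOL-Analysis.Summation_Tests"
begin

text \<open>
  For pairwise coprime A, multiplication by a in A raises the multiplicity of a by one and
  leaves the other multiplicities unchanged. Hence the numbers whose multiplicities at the
  elements of A have even sum form a quotient-free set, whose density follows from the mean
  value of the sign of that sum.

  The bound for arbitrary S cannot be proved by counting on an initial segment, where the even
  numbers in this sense need not be optimal. It holds for the sums of 1/n over n in S, up to a
  bounded error: these weights are multiplicative, and if S has a density, then they see it.
\<close>

section \<open>Multiplicities and sums over multiples\<close>

text \<open>For composite \<open>a\<close> multiplicity need not be additive over products; what
  helps is that every power of \<open>a\<close> is coprime to \<open>b\<close>, so it divides
  \<open>b * n\<close> only if it divides \<open>n\<close>.\<close>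

lemma multiplicity_mult_coprime:
  fixes a b n :: nat
  assumes "1 < a" "coprime a b" "0 < b" "0 < n"
  shows "multiplicity a (b * n) = multiplicity a n"
proof (rule multiplicity_eqI)
  show "a ^ multiplicity a n dvd b * n"
    by (simp add: multiplicity_dvd)
  have "\<not> a ^ Suc (multiplicity a n) dvd n"
    using assms by (subst power_dvd_iff_le_multiplicity) (auto intro: finite_divisor_powers)
  moreover have "coprime (a ^ Suc (multiplicity a n)) b"
    using assms by simp
  ultimately show "\<not> a ^ Suc (multiplicity a n) dvd b * n"
    using coprime_dvd_mult_right_iff by blast
qed

lemma sum_multiples:
  fixes g :: "nat \<Rightarrow> 'b::comm_monoid_add"
  assumes "0 < a"
  shows "sum g {n \<in> {1..N}. a dvd n} = (\<Sum>m=1..N div a. g (a * m))"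
proof (rule sum.reindex_bij_witness[where i = "\<lambda>m. a * m" and j = "\<lambda>n. n div a"])
  fix n assume "n \<in> {n \<in> {1..N}. a dvd n}"
  then show "n div a \<in> {1..N div a}"
    using assms by (auto simp: div_le_mono elim!: dvdE)
next
  fix m assume "m \<in> {1..N div a}"
  then show "a * m \<in> {n \<in> {1..N}. a dvd n}"
    using assms by (auto simp: less_eq_div_iff_mult_less_eq mult.commute)
qed (use assms in auto)

lemma sum_split_multiples:
  fixes g :: "nat \<Rightarrow> 'b::comm_monoid_add"
  assumes "0 < a"
  shows "sum g {1..N} = sum g {n \<in> {1..N}. \<not> a dvd n} + (\<Sum>m=1..N div a. g (a * m))"
proof -
  have "sum g {1..N} = sum g ({n \<in> {1..N}. \<not> a dvd n} \<union> {n \<in> {1..N}. a dvd n})"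
    by (rule arg_cong[where f = "sum g"]) auto
  also have "\<dots> = sum g {n \<in> {1..N}. \<not> a dvd n} + sum g {n \<in> {1..N}. a dvd n}"
    by (rule sum.union_disjoint) auto
  finally show ?thesis
    by (simp only: sum_multiples[OF assms])
qed

section \<open>Mean values under a twist by the parity of one multiplicity\<close>

lemma div_over_self_tendsto:
  assumes "0 < a"
  shows "(\<lambda>N. real (N div a) / real N) \<longlonglongrightarrow> 1 / real a"
proof (rule tendsto_sandwich)
  show "(\<lambda>N. (real N / real a - 1) / real N) \<longlonglongrightarrow> 1 / real a"
    using assms by (real_asymp simp: inverse_eq_divide)
  show "(\<lambda>N. 1 / real a) \<longlonglongrightarrow> 1 / real a"
    by simp
  have "real N / real a - 1 \<le> real (N div a)" for N
  proof -
    have "N < a * (N div a) + a"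
      using dividend_less_times_div[OF assms, of N] by simp
    then have "real N < real a * real (N div a) + real a"
      by (simp flip: of_nat_mult of_nat_add)
    then show ?thesis
      using assms by (simp add: field_simps)
  qed
  then show "\<forall>\<^sub>F N in sequentially. (real N / real a - 1) / real N \<le> real (N div a) / real N"
    by (intro always_eventually allI divide_right_mono) auto
  have "real (N div a) / real N \<le> 1 / real a" for N
  proof (cases "N = 0")
    case False
    have "real (N div a) * real a \<le> real N"
      by (simp flip: of_nat_mult)
    then show ?thesis
      using False assms by (simp add: field_simps)
  qed simp
  then show "\<forall>\<^sub>F N in sequentially. real (N div a) / real N \<le> 1 / real a"
    by simp
qed

text \<open>Up to a small multiple of \<open>N\<close>, the size of \<open>D N\<close> is at most
  that of \<open>D (N div a)\<close>. Iterating, the errors form a geometric series of ratio at most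
  1/2, because \<open>2 \<le> a\<close>, and so at most double.\<close>

lemma sublinear_if_div_sum_sublinear:
  fixes D :: "nat \<Rightarrow> real"
  assumes "2 \<le> a" and lim: "(\<lambda>N. (D N + D (N div a)) / real N) \<longlonglongrightarrow> 0"
  shows "(\<lambda>N. D N / real N) \<longlonglongrightarrow> 0"
proof (rule LIMSEQ_I)
  fix e :: real assume "0 < e"
  \<comment> \<open>The induction costs \<open>2 * d * real N\<close>, and for large
    \<open>N\<close> the constant \<open>M\<close> is below \<open>d * real N\<close>; the total
    stays under four shares of \<open>d\<close>.\<close>
  define d where "d = e / 4"
  have "0 < d" using \<open>0 < e\<close> by (simp add: d_def)
  then obtain N1 where "\<And>N. N \<ge> N1 \<Longrightarrow> \<bar>(D N + D (N div a)) / real N\<bar> < d"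
    using LIMSEQ_D[OF lim, of d] by auto
  \<comment> \<open>Starting at \<open>Suc N1\<close> rather than \<open>N1\<close> makes
    \<open>N\<close> positive, so the denominator can be cleared.\<close>
  then have step: "\<bar>D N + D (N div a)\<bar> \<le> d * real N" if "N \<ge> Suc N1" for N
  proof -
    have "\<bar>D N + D (N div a)\<bar> / real N < d" "0 < real N"
      using \<open>\<And>N. N \<ge> N1 \<Longrightarrow> \<bar>(D N + D (N div a)) / real N\<bar> < d\<close>[of N] that by auto
    then show ?thesis by (simp add: field_simps)
  qed
  define M where "M = (\<Sum>n\<le>N1. \<bar>D n\<bar>)"
  have bound: "\<bar>D N\<bar> \<le> 2 * d * real N + M" for N
  proof (induction N rule: less_induct)
    case (less N)
    show ?case
    proof (cases "N \<le> N1")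
      case True
      then have "\<bar>D N\<bar> \<le> M"
        unfolding M_def by (intro member_le_sum) auto
      moreover have "0 \<le> 2 * d * real N"
        using \<open>0 < d\<close> by simp
      ultimately show ?thesis by linarith
    next
      case False
      have "\<bar>D N\<bar> \<le> d * real N + \<bar>D (N div a)\<bar>"
        using step[of N] False by linarith
      also have "\<bar>D (N div a)\<bar> \<le> 2 * d * real (N div a) + M"
        using False \<open>2 \<le> a\<close> by (intro less.IH) auto
      also have "2 * d * real (N div a) = d * (2 * real (N div a))"
        by simp
      also have "2 * real (N div a) \<le> real N"
      proof -
        have "2 * (N div a) \<le> a * (N div a)"
          using \<open>2 \<le> a\<close> by (rule mult_right_mono) simp
        also have "\<dots> \<le> N" by simp
        finally show ?thesis by linarith
      qed
      finally show ?thesis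
        using \<open>0 < d\<close> by (simp add: mult_left_mono)
    qed
  qed
  have "\<exists>K. real K > M / d"
    by (rule reals_Archimedean2)
  then obtain K where K: "real K > M / d" ..
  show "\<exists>no. \<forall>N\<ge>no. norm (D N / real N - 0) < e"
  proof (intro exI allI impI)
    fix N assume "N \<ge> Suc K"
    then have "0 < real N" "M / d < real N"
      using K by auto
    moreover have "M < d * real N"
      using \<open>M / d < real N\<close> \<open>0 < d\<close> by (simp add: field_simps)
    moreover have "e = 4 * d"
      by (simp add: d_def)
    moreover have "0 < d * real N"
      using \<open>0 < real N\<close> \<open>0 < d\<close> by simp
    ultimately have "\<bar>D N\<bar> < e * real N"
      using bound[of N] by simp
    then show "norm (D N / real N - 0) < e"
      using \<open>0 < real N\<close> by (simp add: field_simps)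
  qed
qed

text \<open>The twisted function agrees with \<open>f\<close> off the multiples of \<open>a\<close>
  and changes sign under multiplication by \<open>a\<close>. This gives a recursion linking its sums
  up to \<open>N\<close> and \<open>N div a\<close>; the deviation from the expected linear growth
  is then sublinear.\<close>

lemma mean_twist_multiplicity_parity:
  fixes f :: "nat \<Rightarrow> real"
  assumes a: "2 \<le> a"
    and f: "\<And>n. 0 < n \<Longrightarrow> f (a * n) = f n"
    and lim: "(\<lambda>N. (\<Sum>n=1..N. f n) / real N) \<longlonglongrightarrow> l"
  shows "(\<lambda>N. (\<Sum>n=1..N. (- 1) ^ multiplicity a n * f n) / real N)
           \<longlonglongrightarrow> (real a - 1) / (real a + 1) * l"
proof -
  define h where "h n = (- 1) ^ multiplicity a n * f n" for n
  define F where "F N = (\<Sum>n=1..N. f n)" for N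
  define H where "H N = (\<Sum>n=1..N. h n)" for N
  \<comment> \<open>If \<open>H N\<close> grows like \<open>\<eta> * real N\<close>, the recursion
    forces \<open>\<eta> * (1 + 1 / a) = l * (1 - 1 / a)\<close>.\<close>
  define \<eta> where "\<eta> = (real a - 1) / (real a + 1) * l"
  define D where "D N = H N - \<eta> * real N" for N
  have h_a: "h (a * n) = - h n" if "0 < n" for n
    using that a by (simp add: h_def f multiplicity_times_same)
  have "H N + H (N div a) = F N - F (N div a)" for N
  proof -
    have "H N = sum f {n \<in> {1..N}. \<not> a dvd n} + (\<Sum>m=1..N div a. h (a * m))"
      unfolding H_def using a
      by (subst sum_split_multiples[of a]) (auto simp: h_def not_dvd_imp_multiplicity_0)
    also have "(\<Sum>m=1..N div a. h (a * m)) = - H (N div a)"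
      unfolding H_def by (simp add: h_a flip: sum_negf)
    also have "sum f {n \<in> {1..N}. \<not> a dvd n} = F N - F (N div a)"
      unfolding F_def using a sum_split_multiples[of a f N] by (simp add: f)
    finally show ?thesis by simp
  qed
  then have H_eq: "H N = F N - F (N div a) - H (N div a)" for N
    by (simp add: algebra_simps)
  \<comment> \<open>For \<open>N div a = 0\<close> the inner quotient is a division by zero, which
    is harmless because \<open>F 0 = 0\<close>.\<close>
  have D_eq: "(D N + D (N div a)) / real N =
      F N / real N - F (N div a) / real (N div a) * (real (N div a) / real N)
        - \<eta> * (real N / real N) - \<eta> * (real (N div a) / real N)" for N
    unfolding D_def H_eq[of N]
    by (cases "N div a = 0")
      (auto simp: F_def H_def diff_divide_distrib add_divide_distrib algebra_simps)
  have F: "(\<lambda>N. F N / real N) \<longlonglongrightarrow> l"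
    using lim by (simp add: F_def)
  have "filterlim (\<lambda>N. N div a) sequentially sequentially"
    using a by (intro filterlim_at_top_div_const_nat) auto
  then have F': "(\<lambda>N. F (N div a) / real (N div a)) \<longlonglongrightarrow> l"
    using F by (rule filterlim_compose[rotated])
  have one: "(\<lambda>N. real N / real N) \<longlonglongrightarrow> 1"
    by real_asymp
  have d: "(\<lambda>N. real (N div a) / real N) \<longlonglongrightarrow> 1 / real a"
    using a by (intro div_over_self_tendsto) auto
  have "(\<lambda>N. (D N + D (N div a)) / real N) \<longlonglongrightarrow> l - l * (1 / real a) - \<eta> * 1 - \<eta> * (1 / real a)"
    unfolding D_eq by (intro tendsto_intros F F' d one)
  also have "l - l * (1 / real a) - \<eta> * 1 - \<eta> * (1 / real a) = 0"
    using a by (simp add: \<eta>_def field_simps)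
  finally have "(\<lambda>N. D N / real N) \<longlonglongrightarrow> 0"
    by (rule sublinear_if_div_sum_sublinear[OF a])
  then have "(\<lambda>N. D N / real N + \<eta> * (real N / real N)) \<longlonglongrightarrow> 0 + \<eta> * 1"
    by (intro tendsto_intros one)
  moreover have "D N / real N + \<eta> * (real N / real N) = H N / real N" for N
    by (simp add: D_def diff_divide_distrib)
  ultimately show ?thesis
    by (simp add: H_def h_def \<eta>_def)
qed

section \<open>The sign of the sum of the multiplicities and its mean value\<close>

text \<open>The elements of A need not be prime: multiplicity a n is the largest k with a^k dividing n.\<close>

definition multiplicity_sign :: "nat set \<Rightarrow> nat \<Rightarrow> real" where
  "multiplicity_sign A n = (\<Prod>a\<in>A. (- 1) ^ multiplicity a n)"

lemma multiplicity_sign_cases: "multiplicity_sign A n = 1 \<or> multiplicity_sign A n = - 1"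
proof -
  have "\<bar>multiplicity_sign A n\<bar> = 1"
    by (simp add: multiplicity_sign_def abs_prod power_abs)
  then show ?thesis by linarith
qed

lemma multiplicity_sign_mult_coprime:
  assumes "\<forall>a\<in>A. 1 < a \<and> coprime a b" "0 < b" "0 < n"
  shows "multiplicity_sign A (b * n) = multiplicity_sign A n"
  using assms by (simp add: multiplicity_sign_def multiplicity_mult_coprime)

lemma multiplicity_sign_mult_mem:
  assumes "finite A" "\<forall>a\<in>A. 2 \<le> a" "pairwise coprime A" "a \<in> A" "0 < n"
  shows "multiplicity_sign A (a * n) = - multiplicity_sign A n"
proof -
  have split: "multiplicity_sign A m = (- 1) ^ multiplicity a m * multiplicity_sign (A - {a}) m" for m
    using assms by (simp add: multiplicity_sign_def prod.remove)
  have "multiplicity_sign (A - {a}) (a * n) = multiplicity_sign (A - {a}) n"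
    using assms by (intro multiplicity_sign_mult_coprime) (force simp: pairwise_def)+
  moreover have "multiplicity a (a * n) = Suc (multiplicity a n)"
    using assms by (intro multiplicity_times_same) auto
  ultimately show ?thesis
    by (simp add: split)
qed

text \<open>The sign for the remaining elements is invariant under multiplication by the new one, so
  each element contributes one twist and one factor, starting from the constant function 1.\<close>

lemma mean_multiplicity_sign:
  assumes "finite A" "\<forall>a\<in>A. 2 \<le> a" "pairwise coprime A"
  shows "(\<lambda>N. (\<Sum>n=1..N. multiplicity_sign A n) / real N)
           \<longlonglongrightarrow> (\<Prod>a\<in>A. (real a - 1) / (real a + 1))"
  using assms
proof (induction A)
  case empty
  have "(\<lambda>N. real N / real N) \<longlonglongrightarrow> 1"
    by real_asymp
  then show ?case
    by (simp add: multiplicity_sign_def)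
next
  case (insert a A)
  have "coprime b a" if "b \<in> A" for b
    using insert that by (auto simp: pairwise_insert)
  then have "multiplicity_sign A (a * n) = multiplicity_sign A n" if "0 < n" for n
    using insert that by (intro multiplicity_sign_mult_coprime) force+
  then show ?case
    using insert mean_twist_multiplicity_parity[of a "multiplicity_sign A"]
    by (simp add: multiplicity_sign_def pairwise_insert)
qed

section \<open>Upper bound for logarithmic sums\<close>

text \<open>There are at most \<open>N\<close> terms, each at most \<open>a / N\<close>. The bound
  is crude, but being independent of \<open>N\<close> it suffices for boundary terms.\<close>

lemma sum_reciprocals_block_le:
  assumes "0 < a"
  shows "(\<Sum>n\<in>{N div a<..N}. 1 / real n) \<le> real a"
proof -
  have "(\<Sum>n\<in>{N div a<..N}. 1 / real n) \<le> (\<Sum>n\<in>{N div a<..N}. real a / real N)"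
  proof (rule sum_mono)
    fix n assume n: "n \<in> {N div a<..N}"
    then have "N \<le> a * n"
      using assms by (simp add: div_less_iff_less_mult mult.commute)
    then have "real N \<le> real a * real n"
      by (simp flip: of_nat_mult)
    then show "1 / real n \<le> real a / real N"
      using n by (simp add: field_simps)
  qed
  also have "\<dots> = real (N - N div a) * (real a / real N)"
    by simp
  also have "\<dots> \<le> real N * (real a / real N)"
    by (intro mult_right_mono) auto
  also have "\<dots> \<le> real a"
    by simp
  finally show ?thesis .
qed

text \<open>A member of \<open>Q\<close> outside \<open>P\<close> has odd multiplicity at
  \<open>a\<close>, so it is \<open>a * m\<close> for a unique \<open>m\<close> in \<open>P\<close>,
  and its weight is that of \<open>m\<close> divided by \<open>a\<close>. The function
  \<open>g\<close> is arbitrary so that the splitting also applies to the total weight.\<close>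

lemma log_sum_split:
  fixes g :: "nat \<Rightarrow> real"
  assumes a: "2 \<le> a" and Q: "\<And>n. 0 < n \<Longrightarrow> a * n \<in> Q \<longleftrightarrow> n \<in> Q"
  defines "P \<equiv> {n \<in> Q. even (multiplicity a n)}"
  shows "(\<Sum>n\<in>{1..N} \<inter> Q. g n / real n) =
    (\<Sum>n\<in>{1..N} \<inter> P. g n / real n) + (\<Sum>n\<in>{1..N div a} \<inter> P. g (a * n) / real n) / real a"
proof -
  define k where "k n = (if n \<in> Q - P then g n / real n else 0)" for n
  have "k n = 0" if "\<not> a dvd n" for n
    using that by (simp add: k_def P_def not_dvd_imp_multiplicity_0)
  then have "sum k {1..N} = (\<Sum>m=1..N div a. k (a * m))"
    using a by (subst sum_split_multiples[of a]) auto
  also have "\<dots> = (\<Sum>m=1..N div a. if m \<in> P then g (a * m) / real m / real a else 0)"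
    using a Q by (intro sum.cong refl) (auto simp: k_def P_def multiplicity_times_same)
  also have "\<dots> = (\<Sum>m\<in>{1..N div a} \<inter> P. g (a * m) / real m) / real a"
    by (simp add: sum.inter_restrict sum_divide_distrib if_distrib[of "\<lambda>t. t / real a"] cong: if_cong)
  finally have "(\<Sum>n\<in>{1..N} \<inter> (Q - P). g n / real n) = \<dots>"
    by (simp add: sum.inter_restrict k_def)
  moreover have "{1..N} \<inter> Q = ({1..N} \<inter> P) \<union> ({1..N} \<inter> (Q - P))"
    by (auto simp: P_def)
  moreover have "sum (\<lambda>n. g n / real n) (({1..N} \<inter> P) \<union> ({1..N} \<inter> (Q - P))) =
      (\<Sum>n\<in>{1..N} \<inter> P. g n / real n) + (\<Sum>n\<in>{1..N} \<inter> (Q - P). g n / real n)"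
    by (rule sum.union_disjoint) auto
  ultimately show ?thesis by simp
qed

text \<open>The set \<open>Q\<close> is there for the induction: splitting off \<open>a\<close>
  restricts to members with even multiplicity at \<open>a\<close>, a set still invariant under the
  other elements. The error \<open>C\<close> may depend on \<open>Q\<close> but not on
  \<open>N\<close>.\<close>

lemma log_sum_bound:
  fixes f :: "nat \<Rightarrow> real"
  assumes "finite A" "\<forall>a\<in>A. 2 \<le> a" "pairwise coprime A"
    and "\<And>n. 0 \<le> f n" "\<And>n. f n \<le> 1"
    and "\<And>a n. a \<in> A \<Longrightarrow> 0 < n \<Longrightarrow> f n + f (a * n) \<le> 1"
    and "\<And>a n. a \<in> A \<Longrightarrow> 0 < n \<Longrightarrow> a * n \<in> Q \<longleftrightarrow> n \<in> Q"
  shows "\<exists>C. \<forall>N. (\<Sum>n\<in>{1..N} \<inter> Q. f n / real n) \<le>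
    1 / 2 * (1 + (\<Prod>a\<in>A. (real a - 1) / (real a + 1))) * (\<Sum>n\<in>{1..N} \<inter> Q. 1 / real n) + C"
  using assms
proof (induction A arbitrary: Q)
  case empty
  then show ?case
    by (intro exI[of _ 0]) (auto intro!: sum_mono divide_right_mono)
next
  case (insert a A)
  \<comment> \<open>Up to boundary terms Q is the union of P and its dilate by a, and in the pair n, a n the
    weights 1, x split as f n + x f (a n) = (1 - x) f n + x (f n + f (a n)): the first part is
    handled by induction, the second by quotient-freeness.\<close>
  define P where "P = {n \<in> Q. even (multiplicity a n)}"
  define p where "p = (\<Prod>b\<in>A. (real b - 1) / (real b + 1))"
  define x where "x = 1 / real a"
  define c where "c = 1 / 2 * (1 + (real a - 1) / (real a + 1) * p)"
  have a: "2 \<le> a" using insert by simp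
  have x: "0 < x" "x < 1" "x * real a = 1" using a by (auto simp: x_def)
  have p: "0 \<le> p"
    unfolding p_def using insert.prems(1) by (intro prod_nonneg) force
  have "(1 - x) * real a = real a - 1" "(1 + x) * real a = real a + 1"
    using x by (simp_all add: algebra_simps)
  then have "(real a - 1) / (real a + 1) = (1 - x) / (1 + x)"
    using a by (metis mult_divide_mult_cancel_right of_nat_eq_0_iff not_numeral_le_zero)
  then have c_eq: "c = 1 / 2 * (1 + (1 - x) / (1 + x) * p)"
    by (simp only: c_def)
  \<comment> \<open>A pair has total weight \<open>1 + x\<close>; the induction constant on weight
    \<open>1 - x\<close> and the pair bound on weight \<open>x\<close> average to exactly
    \<open>c\<close>.\<close>
  then have c: "0 \<le> c" "(1 - x) * (1 / 2 * (1 + p)) + x = c * (1 + x)"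
    unfolding c_eq using x p by (simp, simp add: field_simps)
  have cop: "coprime a b" if "b \<in> A" for b
    using insert.prems(2) insert.hyps that by (auto simp: pairwise_insert)
  have P_A: "b * n \<in> P \<longleftrightarrow> n \<in> P" if "b \<in> A" "0 < n" for b n
    using that insert.prems(1,6) a cop[of b] unfolding P_def
    by (subst mem_Collect_eq, subst multiplicity_mult_coprime) force+
  have "\<exists>C. \<forall>N. (\<Sum>n\<in>{1..N} \<inter> P. f n / real n) \<le>
      1 / 2 * (1 + p) * (\<Sum>n\<in>{1..N} \<inter> P. 1 / real n) + C"
    unfolding p_def
    using insert.prems by (intro insert.IH) (auto simp: pairwise_insert P_A)
  then obtain C where C: "\<And>N. (\<Sum>n\<in>{1..N} \<inter> P. f n / real n) \<le>
      1 / 2 * (1 + p) * (\<Sum>n\<in>{1..N} \<inter> P. 1 / real n) + C"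
    by blast
  have "(\<Sum>n\<in>{1..N} \<inter> Q. f n / real n) \<le>
      c * (\<Sum>n\<in>{1..N} \<inter> Q. 1 / real n) + ((1 - x) * C + c)" for N
  proof -
    define L where "L = (\<Sum>n\<in>{1..N} \<inter> P. 1 / real n)"
    \<comment> \<open>The dilate of \<open>P\<close> inside \<open>Q\<close> reaches only to
      \<open>N div a\<close>. Completing it to \<open>N\<close> costs at most \<open>a\<close>
      before scaling by \<open>x\<close>, hence 1.\<close>
    have L_le: "(1 + x) * L \<le> (\<Sum>n\<in>{1..N} \<inter> Q. 1 / real n) + 1"
    proof -
      have "L = (\<Sum>n\<in>{1..N div a} \<inter> P. 1 / real n) + (\<Sum>n\<in>{N div a<..N} \<inter> P. 1 / real n)"
        unfolding L_def
        by (subst sum.union_disjoint[symmetric])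
          (auto intro!: sum.cong intro: order_trans[OF _ div_le_dividend])
      also have "(\<Sum>n\<in>{N div a<..N} \<inter> P. 1 / real n) \<le> (\<Sum>n\<in>{N div a<..N}. 1 / real n)"
        by (intro sum_mono2) auto
      also have "\<dots> \<le> real a"
        using a by (intro sum_reciprocals_block_le) auto
      finally have "x * L \<le> x * ((\<Sum>n\<in>{1..N div a} \<inter> P. 1 / real n) + real a)"
        using x by (intro mult_left_mono) auto
      then have "(1 + x) * L \<le> L + x * (\<Sum>n\<in>{1..N div a} \<inter> P. 1 / real n) + 1"
        using x by (simp add: algebra_simps)
      also have "L + x * (\<Sum>n\<in>{1..N div a} \<inter> P. 1 / real n) = (\<Sum>n\<in>{1..N} \<inter> Q. 1 / real n)"
        using log_sum_split[OF a, of Q "\<lambda>_. 1" N] insert.prems(6) by (simp add: P_def x_def L_def)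
      finally show ?thesis by simp
    qed
    have "(\<Sum>n\<in>{1..N} \<inter> Q. f n / real n) =
        (\<Sum>n\<in>{1..N} \<inter> P. f n / real n) + x * (\<Sum>n\<in>{1..N div a} \<inter> P. f (a * n) / real n)"
      using log_sum_split[OF a, of Q f N] insert.prems(6) by (simp add: P_def x_def)
    \<comment> \<open>Lengthening the second sum adds only nonnegative terms and makes both sums run
      over the same \<open>n\<close>, so that they can be paired.\<close>
    also have "\<dots> \<le> (\<Sum>n\<in>{1..N} \<inter> P. f n / real n) + x * (\<Sum>n\<in>{1..N} \<inter> P. f (a * n) / real n)"
      using x insert.prems(3)
      by (intro add_mono mult_left_mono sum_mono2) (auto intro: order_trans[OF _ div_le_dividend])
    also have "\<dots> =
        (1 - x) * (\<Sum>n\<in>{1..N} \<inter> P. f n / real n) + x * (\<Sum>n\<in>{1..N} \<inter> P. (f n + f (a * n)) / real n)"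
      by (simp add: sum.distrib add_divide_distrib algebra_simps)
    also have "\<dots> \<le> (1 - x) * (1 / 2 * (1 + p) * L + C) + x * L"
      unfolding L_def using x insert.prems(5)
      by (intro add_mono mult_left_mono C sum_mono divide_right_mono) auto
    also have "\<dots> = ((1 - x) * (1 / 2 * (1 + p)) + x) * L + (1 - x) * C"
      by (simp add: algebra_simps)
    also have "\<dots> = c * ((1 + x) * L) + (1 - x) * C"
      unfolding c(2) by simp
    also have "\<dots> \<le> c * ((\<Sum>n\<in>{1..N} \<inter> Q. 1 / real n) + 1) + (1 - x) * C"
      using c(1) L_le by (simp add: mult_left_mono)
    finally show ?thesis
      by (simp add: algebra_simps)
  qed
  then show ?case
    using insert.hyps by (intro exI[of _ "(1 - x) * C + c"]) (simp add: c_def p_def)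
qed

section \<open>From logarithmic sums to mean values\<close>

text \<open>For positive \<open>N\<close>, summation by parts makes the weighted sum an average of
  the partial sums of \<open>g\<close>, with nonnegative weights \<open>1 / n - 1 / (n + 1)\<close>
  for \<open>n < N\<close> and a last weight \<open>1 / N\<close>.\<close>

lemma log_sum_lower_bound:
  fixes g :: "nat \<Rightarrow> real"
  assumes "\<And>N. - C \<le> (\<Sum>n=1..N. g n)"
  shows "- C \<le> (\<Sum>n=1..N. g n / real n)"
proof (cases N)
  case 0
  then show ?thesis using assms[of 0] by simp
next
  case (Suc M)
  \<comment> \<open>The extra term on the left is the boundary term of summation by parts; without it the induction fails.\<close>
  have "- C + ((\<Sum>n=1..Suc M. g n) + C) / real (Suc M) \<le> (\<Sum>n=1..Suc M. g n / real n)"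
  proof (induction M)
    case (Suc M)
    define G where "G = (\<Sum>n=1..Suc M. g n) + C"
    have "G / real (Suc (Suc M)) \<le> G / real (Suc M)"
      using assms[of "Suc M"] by (intro divide_left_mono) (auto simp: G_def)
    then show ?case
      using Suc.IH
      by (simp add: G_def add_divide_distrib)
  qed simp
  moreover have "0 \<le> ((\<Sum>n=1..Suc M. g n) + C) / real (Suc M)"
    using assms[of "Suc M"] by (intro divide_nonneg_nonneg) auto
  ultimately show ?thesis
    unfolding Suc by linarith
qed

text \<open>If \<open>c < e < d\<close>, the partial sums of \<open>f - e\<close> are bounded below,
  hence so are their logarithmic sums. Together with \<open>le\<close> this bounds the harmonic
  sums, which diverge.\<close>

lemma mean_le_if_log_sum_le:
  fixes f :: "nat \<Rightarrow> real"
  assumes lim: "(\<lambda>N. (\<Sum>n=1..N. f n) / real N) \<longlonglongrightarrow> d"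
    and le: "\<And>N. (\<Sum>n=1..N. f n / real n) \<le> c * (\<Sum>n=1..N. 1 / real n) + C"
  shows "d \<le> c"
proof (rule ccontr)
  assume "\<not> d \<le> c"
  define e where "e = (c + d) / 2"
  have "c < e" "e < d" using \<open>\<not> d \<le> c\<close> by (auto simp: e_def)
  then have "\<forall>\<^sub>F N in sequentially. e < (\<Sum>n=1..N. f n) / real N"
    using order_tendstoD(1)[OF lim] by blast
  then obtain K where K: "\<And>N. N \<ge> K \<Longrightarrow> e < (\<Sum>n=1..N. f n) / real N"
    by (auto simp: eventually_sequentially)
  define g where "g n = f n - e" for n
  \<comment> \<open>Partial sums up to \<open>K\<close> may be negative; \<open>B\<close> dominates
    all of these finitely many values at once.\<close>
  define B where "B = (\<Sum>N\<le>K. \<bar>\<Sum>n=1..N. g n\<bar>)"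
  have "- B \<le> (\<Sum>n=1..N. g n)" for N
  proof (cases "N \<le> K")
    case True
    then have "\<bar>\<Sum>n=1..N. g n\<bar> \<le> B"
      unfolding B_def by (intro member_le_sum[of N _ "\<lambda>N. \<bar>\<Sum>n=1..N. g n\<bar>"]) auto
    then show ?thesis by linarith
  next
    case False
    then have "0 \<le> (\<Sum>n=1..N. g n)"
      using K[of N] by (simp add: g_def sum_subtractf field_simps)
    moreover have "0 \<le> B" by (simp add: B_def sum_nonneg)
    ultimately show ?thesis by linarith
  qed
  then have lower: "- B \<le> (\<Sum>n=1..N. g n / real n)" for N
    by (rule log_sum_lower_bound)
  have eq: "(\<Sum>n=1..N. g n / real n) = (\<Sum>n=1..N. f n / real n) - e * (\<Sum>n=1..N. 1 / real n)" for N
    by (simp add: g_def sum_subtractf diff_divide_distrib sum_distrib_left)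
  have "(e - c) * (\<Sum>n=1..N. 1 / real n) \<le> B + C" for N
    using le[of N] lower[of N] eq[of N] unfolding left_diff_distrib by linarith
  then have bdd: "(\<Sum>n=1..N. 1 / real n) \<le> (B + C) / (e - c)" for N
    using \<open>c < e\<close> by (simp add: field_simps)
  have "summable (\<lambda>n. 1 / real (Suc n))"
  proof (rule summableI_nonneg_bounded)
    show "(\<Sum>i<N. 1 / real (Suc i)) \<le> (B + C) / (e - c)" for N
      using bdd[of N] by (simp add: sum.atLeast1_atMost_eq)
  qed auto
  then show False
    using not_summable_harmonic[where 'a = real] summable_Suc_iff[of "\<lambda>n. inverse (real n)"]
    by (simp add: inverse_eq_divide)
qed

section \<open>Asymptotic density and the two bounds for the supremum\<close>

text \<open>The limit over reals restricts to the integers; conversely, the count depends only on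
  the floor of \<open>X\<close>, whose ratio to \<open>X\<close> tends to 1.\<close>

lemma has_asymp_density_iff:
  "has_asymp_density S d \<longleftrightarrow> (\<lambda>N. (\<Sum>n=1..N. of_bool (n \<in> S)) / real N) \<longlonglongrightarrow> d"
proof -
  define F :: "nat \<Rightarrow> real" where "F N = (\<Sum>n=1..N. of_bool (n \<in> S))" for N
  have seg: "initial_seg X = {1..nat \<lfloor>X\<rfloor>}" for X
  proof -
    \<comment> \<open>For negative \<open>X\<close> the left bound is truncated to 0, and both sides
      fail because \<open>k\<close> is positive.\<close>
    have "k \<le> nat \<lfloor>X\<rfloor> \<longleftrightarrow> real k \<le> X" if "0 < k" for k
    proof
      assume k: "k \<le> nat \<lfloor>X\<rfloor>"
      then have "0 \<le> X"
        using that by (cases "0 \<le> X") (auto simp: nat_floor_neg)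
      then show "real k \<le> X"
        using k of_nat_floor[of X] by linarith
    qed (rule le_nat_floor)
    then show ?thesis
      by (auto simp: initial_seg_def)
  qed
  have F: "real (card (S \<inter> {1..N})) = F N" for N
    by (simp add: F_def Int_commute)
  have dens: "has_asymp_density S d \<longleftrightarrow> ((\<lambda>X. F (nat \<lfloor>X\<rfloor>) / X) \<longlongrightarrow> d) at_top"
    unfolding has_asymp_density_def seg F ..
  show ?thesis
  proof
    assume "has_asymp_density S d"
    then have "((\<lambda>X. F (nat \<lfloor>X\<rfloor>) / X) \<longlongrightarrow> d) at_top"
      by (simp add: dens)
    from filterlim_compose[OF this filterlim_real_sequentially]
    show "(\<lambda>N. (\<Sum>n=1..N. of_bool (n \<in> S)) / real N) \<longlonglongrightarrow> d"
      by (simp add: F_def)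
  next
    assume "(\<lambda>N. (\<Sum>n=1..N. of_bool (n \<in> S)) / real N) \<longlonglongrightarrow> d"
    then have mean: "(\<lambda>N. F N / real N) \<longlonglongrightarrow> d"
      by (simp add: F_def)
    have "filterlim (\<lambda>X::real. nat \<lfloor>X\<rfloor>) sequentially at_top"
      by (intro filterlim_compose[OF filterlim_nat_sequentially] filterlim_floor_sequentially)
    with mean have "((\<lambda>X::real. F (nat \<lfloor>X\<rfloor>) / real (nat \<lfloor>X\<rfloor>)) \<longlongrightarrow> d) at_top"
      by (rule filterlim_compose)
    moreover have "((\<lambda>X::real. real (nat \<lfloor>X\<rfloor>) / X) \<longlongrightarrow> 1) at_top"
    proof (rule tendsto_sandwich)
      show "((\<lambda>X::real. 1 - 1 / X) \<longlongrightarrow> 1) at_top"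
        by real_asymp
      have "1 - 1 / X \<le> real (nat \<lfloor>X\<rfloor>) / X \<and> real (nat \<lfloor>X\<rfloor>) / X \<le> 1" if "0 < X" for X :: real
      proof -
        have "real (nat \<lfloor>X\<rfloor>) = of_int \<lfloor>X\<rfloor>"
          using that by simp
        then have "X - 1 \<le> real (nat \<lfloor>X\<rfloor>)" "real (nat \<lfloor>X\<rfloor>) \<le> X"
          by linarith+
        then have "(X - 1) / X \<le> real (nat \<lfloor>X\<rfloor>) / X" "real (nat \<lfloor>X\<rfloor>) / X \<le> X / X"
          using that by (intro divide_right_mono; simp)+
        then show ?thesis
          using that by (simp add: diff_divide_distrib)
      qed
      then show "\<forall>\<^sub>F X::real in at_top. 1 - 1 / X \<le> real (nat \<lfloor>X\<rfloor>) / X"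
        and "\<forall>\<^sub>F X::real in at_top. real (nat \<lfloor>X\<rfloor>) / X \<le> 1"
        by (auto intro: eventually_mono[OF eventually_gt_at_top[of 0]])
    qed simp
    ultimately have "((\<lambda>X. F (nat \<lfloor>X\<rfloor>) / real (nat \<lfloor>X\<rfloor>) * (real (nat \<lfloor>X\<rfloor>) / X)) \<longlongrightarrow> d * 1) at_top"
      by (rule tendsto_mult)
    \<comment> \<open>Where the floor is truncated to 0, both sides are 0 since
      \<open>F 0 = 0\<close>.\<close>
    moreover have "F (nat \<lfloor>X\<rfloor>) / real (nat \<lfloor>X\<rfloor>) * (real (nat \<lfloor>X\<rfloor>) / X) = F (nat \<lfloor>X\<rfloor>) / X" for X
      by (cases "nat \<lfloor>X\<rfloor> = 0") (auto simp: F_def)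
    ultimately show "has_asymp_density S d"
      by (simp only: dens mult_1_right)
  qed
qed

lemma quotient_free_even_multiplicity_sum:
  assumes "finite A" "\<forall>a\<in>A. 2 \<le> a" "pairwise coprime A"
  shows "quotient_free A {n. 0 < n \<and> multiplicity_sign A n = 1}"
proof -
  have False if "x / real y = real a" "a \<in> A" "0 < y" "x = real x'"
    "multiplicity_sign A x' = 1" "multiplicity_sign A y = 1" for x x' y a
  proof -
    have "real x' = real (a * y)"
      using that by (simp add: field_simps)
    then have "x' = a * y"
      by (simp only: of_nat_eq_iff)
    then show False
      using that multiplicity_sign_mult_mem[OF assms, of a y] by simp
  qed
  then show ?thesis
    by (auto simp: quotient_free_def)
qed

lemma density_even_multiplicity_sum:
  assumes "finite A" "\<forall>a\<in>A. 2 \<le> a" "pairwise coprime A"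
  shows "has_asymp_density {n. 0 < n \<and> multiplicity_sign A n = 1}
           (1 / 2 * (1 + (\<Prod>a\<in>A. (real a - 1) / (real a + 1))))"
proof -
  define S where "S = {n. 0 < n \<and> multiplicity_sign A n = 1}"
  \<comment> \<open>On positive integers the indicator of \<open>S\<close> is half of one plus the
    sign.\<close>
  have "(\<Sum>n=1..N. of_bool (n \<in> S)) = (\<Sum>n=1..N. 1 / 2 * (1 + multiplicity_sign A n))" for N
    using multiplicity_sign_cases by (intro sum.cong) (fastforce simp: S_def)+
  then have eq: "(\<Sum>n=1..N. of_bool (n \<in> S)) / real N =
      1 / 2 * (real N / real N + (\<Sum>n=1..N. multiplicity_sign A n) / real N)" for N
    by (simp add: sum.distrib add_divide_distrib flip: sum_divide_distrib)
  have "(\<lambda>N. real N / real N) \<longlonglongrightarrow> 1"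
    by real_asymp
  then show ?thesis
    unfolding S_def[symmetric] has_asymp_density_iff eq
    by (intro tendsto_intros mean_multiplicity_sign assms)
qed

text \<open>Quotient-freeness says that \<open>n\<close> and \<open>a * n\<close> are never both in
  \<open>S\<close>, which is the pair condition of \<open>log_sum_bound\<close> for the indicator.
  The logarithmic bound with \<open>Q = UNIV\<close> then passes to the density.\<close>

lemma density_quotient_free_le:
  assumes "finite A" "\<forall>a\<in>A. 2 \<le> a" "pairwise coprime A"
    and S: "quotient_free A S" "has_asymp_density S d"
  shows "d \<le> 1 / 2 * (1 + (\<Prod>a\<in>A. (real a - 1) / (real a + 1)))"
proof -
  define f :: "nat \<Rightarrow> real" where "f n = of_bool (n \<in> S)" for n
  have "f n + f (a * n) \<le> 1" if "a \<in> A" "0 < n" for a n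
  proof (cases "n \<in> S \<and> a * n \<in> S")
    case True
    moreover have "real (a * n) / real n = real a"
      using that by simp
    ultimately show ?thesis
      using S(1) \<open>a \<in> A\<close> unfolding quotient_free_def by (metis imageI)
  qed (auto simp: f_def)
  then obtain C where "\<And>N. (\<Sum>n\<in>{1..N} \<inter> UNIV. f n / real n) \<le>
      1 / 2 * (1 + (\<Prod>a\<in>A. (real a - 1) / (real a + 1))) * (\<Sum>n\<in>{1..N} \<inter> UNIV. 1 / real n) + C"
    using log_sum_bound[of A f UNIV] assms by (auto simp: f_def)
  moreover have "(\<lambda>N. (\<Sum>n=1..N. f n) / real N) \<longlonglongrightarrow> d"
    using S(2) unfolding has_asymp_density_iff f_def .
  ultimately show ?thesis
    unfolding Int_UNIV_right by (rule mean_le_if_log_sum_le[rotated])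
qed

theorem theorem4:
  fixes A :: "nat set" and a :: "nat \<Rightarrow> nat" and r :: nat
  assumes "r \<ge> 1"
    and "A = a ` {1..r}"
    and "1 < a 1"
    and "strict_mono_on {1..r} a"
    and "pairwise coprime A"
  shows "rho A = 1 / 2 * (1 + (\<Prod>i=1..r. (real (a i) - 1) / (real (a i) + 1)))"
proof -
  have A: "finite A" "\<forall>b\<in>A. 2 \<le> b" "pairwise coprime A"
    using assms(1-3,5) strict_mono_on_leD[OF assms(4), of 1] by fastforce+
  have "rho A = 1 / 2 * (1 + (\<Prod>b\<in>A. (real b - 1) / (real b + 1)))"
    unfolding rho_def
  \<comment> \<open>The supremum is attained by the set of numbers with sign 1.\<close>
  proof (rule cSup_eq_maximum, unfold mem_Collect_eq)
    show "\<exists>S. quotient_free A S \<and>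
        has_asymp_density S (1 / 2 * (1 + (\<Prod>b\<in>A. (real b - 1) / (real b + 1))))"
      using quotient_free_even_multiplicity_sum[OF A] density_even_multiplicity_sum[OF A] by blast
  next
    fix d assume "\<exists>S. quotient_free A S \<and> has_asymp_density S d"
    then show "d \<le> 1 / 2 * (1 + (\<Prod>b\<in>A. (real b - 1) / (real b + 1)))"
      using density_quotient_free_le[OF A] by blast
  qed
  also have "(\<Prod>b\<in>A. (real b - 1) / (real b + 1)) = (\<Prod>i=1..r. (real (a i) - 1) / (real (a i) + 1))"
    using strict_mono_on_imp_inj_on[OF assms(4)] by (simp add: assms(2) prod.reindex)
  finally show ?thesis .
qed

end
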